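(* Consider the local beeping model and two agents with distinct labels $L_1,L_2$, starting at nodes $v$ and $w$ of an $n$-node graph $G$ in possibly different rounds. Let $\ell=\min(L_1,L_2)$. If both agents execute Algorithm RV-with-detection, then they meet and simultaneously declare rendezvous (they are at the same node and declare rendezvous in the same round) in time $O(P(n,\log \ell))$ after the start of the later agent. In particular this time is polynomial in $n$ and in $\log\ell$.
   Context: **Graphs.** A graph is a simple connected undirected graph with at least two nodes and unlabeled nodes. The edges incident to a node of degree $d$ have distinct port numbers $0,\dots,d-1$ at that node; there is no relation between the two port numbers of an edge at its two endpoints. **Agents.** Two deterministic agents (Turing machines with unlimited memory) have distinct labels that are positive integers. Each agent knows only its own label. It does not know the graph, any bound on its size, or the other agent's label, starting node or activation round. An adversary chooses the starting nodes and activation rounds; each agent appears at its starting node when activated, and the activation round is its round 1. Time proceeds in synchronous rounds. In each round an agent stays at its node or moves through a chosen port to a neighbor; its node in that round is the one reached after this action. On entering a node it learns the node's degree and the port of entry. In each round an agent also either beeps or listens. The later agent is the one activated later (arbitrary choice if simultaneous). **Local beeping model.** An agent hears a beep in a round iff it listens in this round, the other agent (already activated) is at the same node in this round, and the other agent beeps in this round. $\log\ell$ stands for the length of the binary representation of $\ell$ (so it is at least $1$). **The functions $\Phi_L$.** Let $\mathbb Z^+$ be the set of positive integers and $\mathbb Z^*$ the set of integers $\ge -1$. For each label $L$ let $\Phi_L:\mathbb Z^+\times\mathbb Z^+\times\mathbb Z^*\to\mathbb Z^*$. Applying $\Phi_L$ at a node $v$ means performing the following infinite walk $v_0,v_1,\dots$: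 $v_0=v$; $v_1$ is the neighbor of $v_0$ via port $0$; for $t\ge2$, let $d$ be the degree of $v_{t-1}$, and let $p$ be the port at $v_{t-1}$ of the edge $\{v_{t-1},v_{t-2}\}$ if $v_{t-1}\ne v_{t-2}$, and $p=-1$ if $v_{t-1}=v_{t-2}$; if $\Phi_L(t,d,p)=-1$ then $v_t=v_{t-1}$, and if $\Phi_L(t,d,p)=q\ge0$ then $v_t$ is the neighbor of $v_{t-1}$ via port $q$. The agent is at $v_t$ in its $t$-th round. This round is active if $v_t\neq v_{t-1}$ and passive if $v_t=v_{t-1}$. By a theorem of Ta-Shma and Zwick, the functions $\Phi_L$ and a polynomial $P$ in two variables (with values $\geq 1$ at the arguments considered) are fixed so that the following holds: for every $n$-node graph, all distinct labels $L_1,L_2$ with smaller label $\ell$, all starting nodes, all starting rounds $t_1\ge t_2$ and every $t\ge t_1$, if the agent with label $L_i$ applies $\Phi_{L_i}$ at its starting node ($i=1,2$), then in some round of $[t,t+P(n,\log\ell)]$ the agents are at the same node and this round is active for one of them and passive for the other. **Procedure Beeping walk** (agent with label $L$, starting node $v$). Take the walk resulting from applying $\Phi_L$ at $v$ and replace each of its rounds $t$ by two consecutive rounds. If round $t$ is passive: stay at $v_t$ and listen in both rounds. If round $t$ is active: in the first round go to $v_t$ and beep; in the second round stay at $v_t$ and listen. **Algorithm RV-with-detection.** Perform Procedure Beeping walk until you hear a beep; let $s$ be the round in which this happens (counted since your wake-up). From then on stay idle (do not move). Beep in round $s+1$ and listen in round $s+2$. If you hear no beep in round $s+2$, declare rendezvous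 in round $s+3$ and stop. Otherwise listen in round $s+3$, declare rendezvous in round $s+4$ and stop. *)

theory Defs
  imports
    Complex_Main
    "HOL-Library.Log_Nat"
    "HOL-Computational_Algebra.Polynomial"
    "Graph_Theory.Graph_Theory"
begin

section \<open>Port-numbered graphs\<close>

text \<open>An undirected edge \<open>{u, v}\<close> is the pair of arcs \<open>(u, v)\<close>, \<open>(v, u)\<close>, so the degree of a node is
  its out-degree. The number \<open>port u v\<close> is the port at \<open>u\<close> of the edge \<open>{u, v}\<close>.\<close>

locale port_graph = pair_graph G
  for G :: "'v pair_pre_digraph" and port :: "'v \<Rightarrow> 'v \<Rightarrow> nat" +
  assumes graph_connected: "Digraph_Component.connected (with_proj G)"
    and two_nodes: "card (pverts G) \<ge> 2"
    and port_numbering: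
      "\<And>u. u \<in> pverts G \<Longrightarrow>
         bij_betw (port u) {v. (u, v) \<in> parcs G} {..<out_degree (with_proj G) u}"

definition deg :: "'v pair_pre_digraph \<Rightarrow> 'v \<Rightarrow> nat" where
  "deg G u = out_degree (with_proj G) u"

text \<open>Convention: a port that does not exist at \<open>u\<close> leads nowhere, i.e. leaves the agent at \<open>u\<close>.\<close>

definition via_port :: "'v pair_pre_digraph \<Rightarrow> ('v \<Rightarrow> 'v \<Rightarrow> nat) \<Rightarrow> 'v \<Rightarrow> nat \<Rightarrow> 'v" where
  "via_port G port u q =
     (if q < deg G u then (THE v. (u, v) \<in> parcs G \<and> port u v = q) else u)"

text \<open>The port at the current node \<open>v\<close> leading back to the previous node \<open>u\<close>, or \<open>-1\<close> if the agent
  did not move.\<close>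

definition entry_port :: "('v \<Rightarrow> 'v \<Rightarrow> nat) \<Rightarrow> 'v \<Rightarrow> 'v \<Rightarrow> int" where
  "entry_port port u v = (if v \<noteq> u then int (port v u) else - 1)"


section \<open>The walks determined by the functions \<open>\<Phi>\<^sub>L\<close>\<close>

text \<open>The arguments of \<open>\<Phi>\<^sub>L\<close> are the time, the degree and the entry port (or \<open>-1\<close>).\<close>

type_synonym walk_fun = "nat \<Rightarrow> nat \<Rightarrow> int \<Rightarrow> int"

definition walk_fun_range :: "walk_fun \<Rightarrow> bool" where
  "walk_fun_range \<phi> \<longleftrightarrow> (\<forall>t d p. t > 0 \<and> d > 0 \<and> p \<ge> - 1 \<longrightarrow> \<phi> t d p \<ge> - 1)"

fun phi_walk ::
  "'v pair_pre_digraph \<Rightarrow> ('v \<Rightarrow> 'v \<Rightarrow> nat) \<Rightarrow> walk_fun \<Rightarrow> 'v \<Rightarrow> nat \<Rightarrow> 'v" where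
  "phi_walk G port \<phi> v 0 = v"
| "phi_walk G port \<phi> v (Suc 0) = via_port G port v 0"
| "phi_walk G port \<phi> v (Suc (Suc k)) =
     (let x = phi_walk G port \<phi> v (Suc k);
          q = \<phi> (Suc (Suc k)) (deg G x) (entry_port port (phi_walk G port \<phi> v k) x)
      in if q < 0 then x else via_port G port x (nat q))"

definition active_round ::
  "'v pair_pre_digraph \<Rightarrow> ('v \<Rightarrow> 'v \<Rightarrow> nat) \<Rightarrow> walk_fun \<Rightarrow> 'v \<Rightarrow> nat \<Rightarrow> bool" where
  "active_round G port \<phi> v t \<longleftrightarrow> phi_walk G port \<phi> v t \<noteq> phi_walk G port \<phi> v (t - 1)"

text \<open>A polynomial in two variables is a polynomial in the second variable whose coefficients are
  polynomials in the first one.\<close>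

definition poly2 :: "real poly poly \<Rightarrow> real \<Rightarrow> real \<Rightarrow> real" where
  "poly2 P x y = poly (poly P [:y:]) x"

text \<open>The length of the binary representation of a label \<open>l\<close> is \<open>floorlog 2 l\<close>. Rounds of the common
  clock are natural numbers; an agent activated in round \<open>s\<close> is in its own round \<open>r - s + 1\<close> during
  the common round \<open>r \<ge> s\<close>.\<close>

definition meeting_guarantee ::
  "'v pair_pre_digraph \<Rightarrow> ('v \<Rightarrow> 'v \<Rightarrow> nat) \<Rightarrow> (nat \<Rightarrow> walk_fun) \<Rightarrow> real poly poly \<Rightarrow> bool" where
  "meeting_guarantee G port \<Phi> P \<longleftrightarrow>
     (\<forall>L1 L2 v1 v2 t1 t2 t.
        L1 > 0 \<and> L2 > 0 \<and> L1 \<noteq> L2 \<and> v1 \<in> pverts G \<and> v2 \<in> pverts G \<and> t1 \<ge> t2 \<and> t \<ge> t1 \<longrightarrow>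
        (\<exists>r\<ge>t. real r \<le> real t + poly2 P (card (pverts G)) (floorlog 2 (min L1 L2)) \<and>
           phi_walk G port (\<Phi> L1) v1 (r - t1 + 1) = phi_walk G port (\<Phi> L2) v2 (r - t2 + 1) \<and>
           active_round G port (\<Phi> L1) v1 (r - t1 + 1)
             \<noteq> active_round G port (\<Phi> L2) v2 (r - t2 + 1)))"


section \<open>The local beeping model\<close>

datatype move = Stay | Go nat
datatype signal = Beep | Listen

datatype action = Action (move_of: move) (signal_of: signal) (declares_rv: bool)

text \<open>What an agent perceives in a round: the degree of its node, its port of entry (\<open>-1\<close> if it
  stayed) and whether it heard a beep.\<close>

datatype percept = Percept (degree_of: nat) (entry_of: int) (heard: bool)

text \<open>A deterministic algorithm chooses the action of the next round from the agent's label and the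
  list of its percepts so far. Position \<open>0\<close> of this list is the percept on appearing at the starting
  node and position \<open>k > 0\<close> that of the agent's \<open>k\<close>-th round, so the length of the list is the
  number of the agent's next round.\<close>

type_synonym algorithm = "nat \<Rightarrow> percept list \<Rightarrow> action"

datatype agent = Agent1 | Agent2

fun other :: "agent \<Rightarrow> agent" where
  "other Agent1 = Agent2"
| "other Agent2 = Agent1"

locale local_beeping =
  fixes G :: "'v pair_pre_digraph" and port :: "'v \<Rightarrow> 'v \<Rightarrow> nat"
    and alg :: algorithm
    and L :: "agent \<Rightarrow> nat" and start :: "agent \<Rightarrow> 'v" and wake :: "agent \<Rightarrow> nat"
begin

text \<open>A configuration assigns to each agent its node and its percepts so far.\<close>

definition next_action :: "(agent \<Rightarrow> 'v \<times> percept list) \<Rightarrow> agent \<Rightarrow> action" where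
  "next_action c i = alg (L i) (snd (c i))"

definition next_node :: "(agent \<Rightarrow> 'v \<times> percept list) \<Rightarrow> agent \<Rightarrow> 'v" where
  "next_node c i =
     (case move_of (next_action c i) of Stay \<Rightarrow> fst (c i) | Go q \<Rightarrow> via_port G port (fst (c i)) q)"

definition hears :: "nat \<Rightarrow> (agent \<Rightarrow> 'v \<times> percept list) \<Rightarrow> agent \<Rightarrow> bool" where
  "hears r c i \<longleftrightarrow>
     signal_of (next_action c i) = Listen \<and> wake (other i) \<le> r \<and>
     next_node c (other i) = next_node c i \<and> signal_of (next_action c (other i)) = Beep"

text \<open>The configuration just before round \<open>r\<close>. Before its activation an agent merely carries its
  initial data; it takes no action and is ignored by the other agent.\<close>

primrec config :: "nat \<Rightarrow> agent \<Rightarrow> 'v \<times> percept list" where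
  "config 0 = (\<lambda>i. (start i, [Percept (deg G (start i)) (- 1) False]))"
| "config (Suc r) = (\<lambda>i.
     if wake i \<le> r
     then (next_node (config r) i,
           snd (config r i) @
             [Percept (deg G (next_node (config r) i))
                (entry_port port (fst (config r i)) (next_node (config r) i))
                (hears r (config r) i)])
     else config r i)"

text \<open>The node reached after the action of round \<open>r\<close>; meaningful only for \<open>r \<ge> wake i\<close>.\<close>

definition node_in_round :: "agent \<Rightarrow> nat \<Rightarrow> 'v" where
  "node_in_round i r = next_node (config r) i"

definition declares_in_round :: "agent \<Rightarrow> nat \<Rightarrow> bool" where
  "declares_in_round i r \<longleftrightarrow> wake i \<le> r \<and> declares_rv (next_action (config r) i)"

end


section \<open>The algorithm\<close>

text \<open>Round \<open>t\<close> of the walk determined by \<open>\<Phi>\<^sub>L\<close> becomes the agent's rounds \<open>j = 2 t - 1\<close> and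
  \<open>j = 2 t\<close>. Since the agent stays put in even rounds, its current node before round \<open>2 t - 1\<close> is
  \<open>v\<^sub>t\<^sub>-\<^sub>1\<close>, and the port of \<open>v\<^sub>t\<^sub>-\<^sub>1\<close> towards \<open>v\<^sub>t\<^sub>-\<^sub>2\<close> was perceived in round \<open>2 (t - 1) - 1 = j - 2\<close>.\<close>

definition beeping_walk :: "(nat \<Rightarrow> walk_fun) \<Rightarrow> algorithm" where
  "beeping_walk \<Phi> L h =
     (let j = length h; t = (j + 1) div 2 in
      if even j then Action Stay Listen False
      else if t = 1 then Action (Go 0) Beep False
      else
        let d = degree_of (h ! (j - 1)); p = entry_of (h ! (j - 2)); q = \<Phi> L t d p in
        if 0 \<le> q \<and> q < int d then Action (Go (nat q)) Beep False
        else Action Stay Listen False)"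

text \<open>An agent that has stopped remains at its node, silent.\<close>

definition rv_with_detection :: "(nat \<Rightarrow> walk_fun) \<Rightarrow> algorithm" where
  "rv_with_detection \<Phi> L h =
     (if \<forall>x\<in>set h. \<not> heard x then beeping_walk \<Phi> L h
      else
        let j = length h; s = (LEAST k. k < length h \<and> heard (h ! k)) in
        if j = s + 1 then Action Stay Beep False
        else if j = s + 2 then Action Stay Listen False
        else if \<not> heard (h ! (s + 2)) then Action Stay Listen (j = s + 3)
        else Action Stay Listen (j = s + 4))"

end

theory Submission
  imports Defs
begin

text \<open>While nobody has heard a beep, both agents follow their walks at half speed. Since only moving agents
  beep, and every move is followed by a round of silent waiting, the first hearing is one-sided: one agent
  hears in round \<open>s\<close>, its partner hears the answer in round \<open>s + 1\<close>, and the final exchange makes both declare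
  in round \<open>s + 4\<close>. A meeting that is active for exactly one agent forces a hearing whatever the parity of
  the difference of the wake-up times, so \<open>s\<close> comes at most \<open>2 P\<close> rounds after the later wake-up, and the
  total \<open>2 P + 5\<close> is at most \<open>7 P\<close> because \<open>P \<ge> 1\<close>.\<close>

section \<open>Ports, degrees and walks in the graph\<close>

context port_graph
begin

lemma via_port_arc:
  assumes "u \<in> pverts G" "q < deg G u"
  shows "(u, via_port G port u q) \<in> parcs G"
proof -
  have bij: "bij_betw (port u) {v. (u, v) \<in> parcs G} {..<deg G u}"
    using port_numbering[OF assms(1)] by (simp add: deg_def)
  then have "q \<in> port u ` {v. (u, v) \<in> parcs G}"
    using assms(2) by (simp add: bij_betw_def)
  then obtain v where "(u, v) \<in> parcs G" "port u v = q"
    by auto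
  then have "\<exists>!v. (u, v) \<in> parcs G \<and> port u v = q"
    using bij by (auto simp: bij_betw_def inj_on_def)
  from theI'[OF this] show ?thesis
    using assms(2) by (simp add: via_port_def)
qed

lemma via_port_in_pverts: "u \<in> pverts G \<Longrightarrow> via_port G port u q \<in> pverts G"
  using via_port_arc[of u q] in_arcsD2 by (cases "q < deg G u") (auto simp: via_port_def)

text \<open>There are no loops, so leaving through an existing port makes a walk round
  active.\<close>

lemma via_port_neq:
  assumes "u \<in> pverts G" "q < deg G u"
  shows "via_port G port u q \<noteq> u"
  using pair_no_loops[OF via_port_arc[OF assms]] by auto

text \<open>A second node is reachable from \<open>u\<close>, so some arc leaves \<open>u\<close>.
  Hence port \<open>0\<close> exists, which makes the first walk round active.\<close>

lemma deg_pos: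
  assumes "u \<in> pverts G"
  shows "deg G u > 0"
proof -
  have "\<not> pverts G \<subseteq> {u}"
    using two_nodes card_mono[of "{u}" "pverts G"] by auto
  then obtain v where v: "v \<in> pverts G" "v \<noteq> u" by blast
  have "u \<rightarrow>\<^sup>*\<^bsub>mk_symmetric (with_proj G)\<^esub> v"
    using graph_connected assms v
    by (auto simp: Digraph_Component.connected_def strongly_connected_def)
  then have "u \<rightarrow>\<^sup>*\<^bsub>with_proj G\<^esub> v"
    by (simp only: reachable_mk_symmetric_eq[OF sym_arcs])
  then obtain w where "(u, w) \<in> parcs G"
    using v by (cases rule: pre_digraph.converse_reachable_cases) auto
  then have "out_arcs (with_proj G) u \<noteq> {}"
    by (auto simp: out_arcs_def)
  moreover have "finite (out_arcs (with_proj G) u)"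
    by (rule finite_subset[OF _ pair_finite_arcs]) (auto simp: out_arcs_def)
  ultimately show ?thesis
    by (simp add: deg_def out_degree_def card_gt_0_iff)
qed

lemma phi_walk_in_pverts: "v \<in> pverts G \<Longrightarrow> phi_walk G port \<phi> v t \<in> pverts G"
proof (induction t rule: induct_nat_012)
  case (ge2 n)
  then show ?case by (simp add: Let_def via_port_in_pverts del: phi_walk.simps(1,2))
qed (auto simp: via_port_in_pverts)

lemma active_round_1:
  assumes "v \<in> pverts G"
  shows "active_round G port \<phi> v (Suc 0)"
  using via_port_neq[OF assms deg_pos[OF assms]] by (simp add: active_round_def)

end

lemma phi_walk_passive:
  "t > 0 \<Longrightarrow> \<not> active_round G port \<phi> v t \<Longrightarrow> phi_walk G port \<phi> v (t - 1) = phi_walk G port \<phi> v t"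
  by (simp add: active_round_def)

lemma other_other [simp]: "other (other i) = i"
  by (cases i) auto

lemma all_agent_iff: "(\<forall>i. Q i) \<longleftrightarrow> Q a \<and> Q (other a)"
  by (cases a) (metis agent.exhaust other.simps)+

section \<open>Hearing events and recorded percepts\<close>

context local_beeping
begin

definition hears_in_round :: "agent \<Rightarrow> nat \<Rightarrow> bool" where
  "hears_in_round i r \<longleftrightarrow> wake i \<le> r \<and> hears r (config r) i"

text \<open>This is the agent's own number of round \<open>r\<close>; before the activation,
  truncated subtraction gives \<open>1\<close>, for the initial percept alone.\<close>

lemma length_percepts: "length (snd (config r i)) = Suc (r - wake i)"
  by (induction r) (auto simp: Suc_diff_le)

lemma node_config_Suc: "wake i \<le> r \<Longrightarrow> fst (config (Suc r) i) = node_in_round i r"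
  by (simp add: node_in_round_def)

lemma node_in_round_Stay:
  "move_of (next_action (config r) i) = Stay \<Longrightarrow> node_in_round i r = fst (config r i)"
  by (simp add: node_in_round_def next_node_def)

lemma hears_in_round_iff:
  "hears_in_round i r \<longleftrightarrow> wake i \<le> r \<and> wake (other i) \<le> r \<and>
     node_in_round (other i) r = node_in_round i r \<and>
     signal_of (next_action (config r) i) = Listen \<and>
     signal_of (next_action (config r) (other i)) = Beep"
  by (auto simp: hears_in_round_def hears_def node_in_round_def)

lemma percept_0: "snd (config r i) ! 0 = Percept (deg G (start i)) (- 1) False"
proof (induction r)
  case (Suc r)
  moreover have "snd (config r i) \<noteq> []"
    using length_percepts[of r i] by auto
  ultimately show ?case by (auto simp: nth_append)
qed simp

lemma percept_Suc:
  assumes "wake i \<le> r'" "r' < r"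
  shows "snd (config r i) ! Suc (r' - wake i) =
    Percept (deg G (node_in_round i r')) (entry_port port (fst (config r' i)) (node_in_round i r'))
      (hears_in_round i r')"
  using assms(2)
proof (induction r)
  case (Suc r)
  then show ?case
    using assms(1) length_percepts[of r i]
    by (cases "r' = r") (auto simp: nth_append node_in_round_def hears_in_round_def)
qed simp

text \<open>Turns the algorithm's test of its memory into a statement about rounds of the common
  clock; the initial percept contains no beep.\<close>

lemma heard_percept_iff:
  "(\<exists>x\<in>set (snd (config r i)). heard x) \<longleftrightarrow> (\<exists>r'<r. hears_in_round i r')"
  by (induction r) (auto simp: hears_in_round_def less_Suc_eq)

text \<open>Percepts are stored in the order of rounds, so the position that the algorithm computes
  is the own number of the common round \<open>s\<close>.\<close>

lemma Least_heard:
  assumes hears: "hears_in_round i s" and first: "\<And>r'. r' < s \<Longrightarrow> \<not> hears_in_round i r'"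
    and "s < r"
  defines "h \<equiv> snd (config r i)"
  shows "(LEAST k. k < length h \<and> heard (h ! k)) = Suc (s - wake i)"
proof (rule Least_equality)
  have "wake i \<le> s"
    using hears by (simp add: hears_in_round_def)
  then show "Suc (s - wake i) < length h \<and> heard (h ! Suc (s - wake i))"
    using assms by (simp add: h_def length_percepts percept_Suc diff_less_mono)
next
  fix k
  assume k: "k < length h \<and> heard (h ! k)"
  show "Suc (s - wake i) \<le> k"
  proof (cases k)
    case 0
    then show ?thesis using k by (simp add: h_def percept_0)
  next
    case (Suc k')
    then have "wake i + k' < r"
      using k by (simp add: h_def length_percepts less_diff_conv add.commute)
    then have "hears_in_round i (wake i + k')"
      using percept_Suc[of i "wake i + k'" r] k Suc by (simp add: h_def)
    then have "s \<le> wake i + k'"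
      using first not_less by blast
    then show ?thesis using Suc by simp
  qed
qed

declare config.simps [simp del]

end

lemma rv_with_detection_quiet:
  "\<forall>x\<in>set h. \<not> heard x \<Longrightarrow> rv_with_detection \<Phi> l h = beeping_walk \<Phi> l h"
  by (simp add: rv_with_detection_def)

text \<open>Merges the last two branches of the algorithm: the second answer only decides between
  own rounds \<open>k + 3\<close> and \<open>k + 4\<close> for the declaration.\<close>

lemma rv_with_detection_heard:
  assumes "\<exists>x\<in>set h. heard x" "(LEAST k. k < length h \<and> heard (h ! k)) = k"
  shows "rv_with_detection \<Phi> l h =
    (if length h = k + 1 then Action Stay Beep False
     else if length h = k + 2 then Action Stay Listen False
     else Action Stay Listen (length h = (if heard (h ! (k + 2)) then k + 4 else k + 3)))"
proof -
  have not_quiet: "\<not> (\<forall>x\<in>set h. \<not> heard x)"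
    using assms(1) by blast
  show ?thesis
    unfolding rv_with_detection_def Let_def assms(2) if_not_P[OF not_quiet] by simp
qed

section \<open>Actions of an agent before and after its first hearing\<close>

locale rv_run =
  port_graph G port + local_beeping G port "rv_with_detection \<Phi>" L start wake
  for G :: "'v pair_pre_digraph" and port :: "'v \<Rightarrow> 'v \<Rightarrow> nat" and \<Phi> :: "nat \<Rightarrow> walk_fun"
    and L :: "agent \<Rightarrow> nat" and start :: "agent \<Rightarrow> 'v" and wake :: "agent \<Rightarrow> nat" +
  assumes start_in_pverts: "start i \<in> pverts G"
begin

abbreviation walk :: "agent \<Rightarrow> nat \<Rightarrow> 'v" where
  "walk i \<equiv> phi_walk G port (\<Phi> (L i)) (start i)"

abbreviation active :: "agent \<Rightarrow> nat \<Rightarrow> bool" where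
  "active i \<equiv> active_round G port (\<Phi> (L i)) (start i)"

text \<open>Only rounds of \<open>i\<close> itself count, so the notion also fits the partner that
  hears one round later.\<close>

definition first_hearing :: "agent \<Rightarrow> nat \<Rightarrow> bool" where
  "first_hearing i s \<longleftrightarrow> hears_in_round i s \<and> (\<forall>r<s. \<not> hears_in_round i r)"

lemma action_before_hearing:
  assumes "\<And>r'. r' < r \<Longrightarrow> \<not> hears_in_round i r'"
  shows "next_action (config r) i = beeping_walk \<Phi> (L i) (snd (config r i))"
  unfolding next_action_def using assms heard_percept_iff[of r i]
  by (intro rv_with_detection_quiet) blast

lemma no_declaration_before_hearing:
  assumes "\<And>r'. r' < r \<Longrightarrow> \<not> hears_in_round i r'"
  shows "\<not> declares_in_round i r"
  by (auto simp: declares_in_round_def action_before_hearing[OF assms] beeping_walk_def Let_def)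

text \<open>The algorithm only uses differences of own round numbers, in which the wake-up time
  cancels, so its schedule reads the same on the common clock.\<close>

lemma action_after_hearing:
  assumes "first_hearing i s" "s < r"
  shows "next_action (config r) i =
    (if r = s + 1 then Action Stay Beep False
     else if r = s + 2 then Action Stay Listen False
     else Action Stay Listen (r = (if hears_in_round i (s + 2) then s + 4 else s + 3)))"
proof -
  have wake: "wake i \<le> s"
    using assms(1) by (simp add: first_hearing_def hears_in_round_def)
  let ?h = "snd (config r i)"
  let ?k = "Suc (s - wake i)"
  have "\<exists>x\<in>set ?h. heard x"
    using heard_percept_iff[of r i] assms by (auto simp: first_hearing_def)
  moreover have "(LEAST k. k < length ?h \<and> heard (?h ! k)) = ?k"
    using assms by (intro Least_heard) (auto simp: first_hearing_def)
  ultimately have action: "next_action (config r) i =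
    (if length ?h = ?k + 1 then Action Stay Beep False
     else if length ?h = ?k + 2 then Action Stay Listen False
     else Action Stay Listen (length ?h = (if heard (?h ! (?k + 2)) then ?k + 4 else ?k + 3)))"
    unfolding next_action_def by (rule rv_with_detection_heard)
  have len: "length ?h = ?k + (r - s)"
    using wake assms(2) by (simp add: length_percepts)
  consider "r = s + 1" | "r = s + 2" | "s + 2 < r"
    using assms(2) by linarith
  then show ?thesis
  proof cases
    case 3
    have "?k + 2 = Suc (s + 2 - wake i)"
      using wake by simp
    then have second: "heard (?h ! (?k + 2)) = hears_in_round i (s + 2)"
      using wake 3 percept_Suc[of i "s + 2" r] by simp
    have "length ?h \<noteq> ?k + 1" "length ?h \<noteq> ?k + 2"
      "length ?h = ?k + 3 \<longleftrightarrow> r = s + 3" "length ?h = ?k + 4 \<longleftrightarrow> r = s + 4"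
      unfolding len using 3 by auto
    then show ?thesis
      using 3 unfolding action second by simp
  qed (use action len in simp_all)
qed

lemma node_after_hearing:
  assumes "first_hearing i s" "s < r"
  shows "node_in_round i r = node_in_round i s"
  using assms(2)
proof (induction r)
  case (Suc r)
  have stay: "node_in_round i (Suc r) = fst (config (Suc r) i)"
    using action_after_hearing[OF assms(1) Suc.prems]
    by (intro node_in_round_Stay) simp
  have "wake i \<le> s"
    using assms(1) by (simp add: first_hearing_def hears_in_round_def)
  then have "node_in_round i (Suc r) = node_in_round i r"
    using stay Suc.prems by (simp add: node_config_Suc)
  then show ?case
    using Suc by (cases "s = r") auto
qed simp

text \<open>After its own round \<open>j\<close> an agent that has heard nothing is at node \<open>(j + 1) div 2\<close> of its walk.\<close>

lemma beeping_walk_step: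
  fixes i j
  defines "W \<equiv> walk i"
  assumes len: "length h = j" "j > 0"
    and deg: "\<And>k. k < j \<Longrightarrow> degree_of (h ! k) = deg G (W (Suc k div 2))"
    and entry: "\<And>k. k < j \<Longrightarrow> entry_of (h ! k) = entry_port port (W (k div 2)) (W (Suc k div 2))"
  defines "a \<equiv> beeping_walk \<Phi> (L i) h"
  shows "(case move_of a of Stay \<Rightarrow> W (j div 2) | Go q \<Rightarrow> via_port G port (W (j div 2)) q)
           = W (Suc j div 2)"
    and "signal_of a = Beep \<longleftrightarrow> odd j \<and> active i (Suc j div 2)"
proof -
  have "(case move_of a of Stay \<Rightarrow> W (j div 2) | Go q \<Rightarrow> via_port G port (W (j div 2)) q)
           = W (Suc j div 2) \<and> (signal_of a = Beep \<longleftrightarrow> odd j \<and> active i (Suc j div 2))"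
  proof (cases "even j")
    case True
    then show ?thesis
      using len by (simp add: a_def beeping_walk_def Let_def)
  next
    case False
    then obtain u where u: "j = 2 * u + 1" by (elim oddE)
    show ?thesis
    proof (cases u)
      case 0
      then show ?thesis
        using u len active_round_1[OF start_in_pverts[of i]]
        by (simp add: a_def beeping_walk_def Let_def W_def)
    next
      case (Suc u')
      define x where "x = W (Suc u')"
      define q where "q = \<Phi> (L i) (Suc (Suc u')) (deg G x) (entry_port port (W u') x)"
      have W: "W (Suc (Suc u')) = (if q < 0 then x else via_port G port x (nat q))"
        by (simp add: W_def x_def q_def Let_def del: phi_walk.simps(2))
      have x: "x \<in> pverts G"
        by (simp add: x_def W_def phi_walk_in_pverts start_in_pverts)
      have degree: "degree_of (h ! Suc (Suc (2 * u'))) = deg G x"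
        using deg[of "Suc (Suc (2 * u'))"] u Suc by (simp add: x_def)
      \<comment> \<open>The entry port is read one position before the degree: the latest own round
        was a wait, whose percept has entry \<open>-1\<close>.\<close>
      have entry: "entry_of (h ! Suc (2 * u')) = entry_port port (W u') x"
        using entry[of "Suc (2 * u')"] u Suc by (simp add: x_def)
      have a: "a = (if 0 \<le> q \<and> q < int (deg G x) then Action (Go (nat q)) Beep False
                    else Action Stay Listen False)"
        using len u Suc by (simp add: a_def beeping_walk_def Let_def degree entry q_def)
      have "nat q < deg G x" if "0 \<le> q" "q < int (deg G x)"
        using that by linarith
      \<comment> \<open>A missing port leaves the walk in place by \<open>via_port_def\<close>, an
        existing one moves it, so the algorithm's test on \<open>q\<close> detects exactly the
        active rounds.\<close>
      then have "active i (Suc (Suc u')) \<longleftrightarrow> 0 \<le> q \<and> q < int (deg G x)"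
        using W via_port_neq[OF x, of "nat q"]
        by (auto simp: active_round_def W_def[symmetric] x_def[symmetric] via_port_def
            split: if_splits simp del: phi_walk.simps)
      then show ?thesis
        using u Suc W a by (auto simp: x_def[symmetric] via_port_def)
    qed
  qed
  then show "(case move_of a of Stay \<Rightarrow> W (j div 2) | Go q \<Rightarrow> via_port G port (W (j div 2)) q)
           = W (Suc j div 2)"
    and "signal_of a = Beep \<longleftrightarrow> odd j \<and> active i (Suc j div 2)"
    by auto
qed

text \<open>By strong induction the earlier percepts describe the walk, as
  \<open>beeping_walk_step\<close> requires. Round \<open>r\<close> itself may bring a beep, since
  its action is chosen beforehand.\<close>

lemma run_before_hearing:
  assumes "wake i \<le> r" "\<And>r'. r' < r \<Longrightarrow> \<not> hears_in_round i r'"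
  defines "j \<equiv> Suc (r - wake i)"
  shows "node_in_round i r = walk i (Suc j div 2)"
    and "signal_of (next_action (config r) i) = Beep \<longleftrightarrow> odd j \<and> active i (Suc j div 2)"
proof -
  have "node_in_round i r = walk i (Suc j div 2) \<and>
    (signal_of (next_action (config r) i) = Beep \<longleftrightarrow> odd j \<and> active i (Suc j div 2))"
    using assms(1,2) unfolding j_def
  proof (induction r rule: less_induct)
    case (less r)
    let ?j = "Suc (r - wake i)"
    let ?h = "snd (config r i)"
    have node: "fst (config r' i) = walk i (Suc (r' - wake i) div 2)" if "wake i \<le> r'" "r' \<le> r" for r'
    proof (cases "wake i = r'")
      case True
      have "fst (config k i) = start i" if "k \<le> wake i" for k
        using that by (induction k) (auto simp: config.simps)
      then show ?thesis using True by simp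
    next
      case False
      then have "r' = Suc (r' - 1)" "wake i \<le> r' - 1"
        using that by linarith+
      then obtain k where k: "r' = Suc k" "wake i \<le> k"
        by blast
      then show ?thesis
        using less that by (simp add: node_config_Suc Suc_diff_le)
    qed
    have percepts: "degree_of (?h ! k) = deg G (walk i (Suc k div 2)) \<and>
        entry_of (?h ! k) = entry_port port (walk i (k div 2)) (walk i (Suc k div 2))"
      if "k < ?j" for k
    proof (cases k)
      case 0
      \<comment> \<open>The initial percept fits the same formula, as \<open>Suc 0 div 2 = 0\<close>
        and the entry port from a node to itself is \<open>-1\<close>.\<close>
      then show ?thesis by (simp add: percept_0 entry_port_def)
    next
      case (Suc k')
      have k': "wake i + k' < r" "wake i \<le> wake i + k'"
        using that Suc by auto
      have "node_in_round i (wake i + k') = walk i (Suc k div 2)"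
        using less.IH[OF k'] less.prems k' Suc by simp
      then show ?thesis
        using percept_Suc[of i "wake i + k'" r] node[of "wake i + k'"] k' Suc by simp
    qed
    have "next_action (config r) i = beeping_walk \<Phi> (L i) ?h"
      using less.prems(2) by (rule action_before_hearing)
    then show ?case
      using beeping_walk_step[of ?h ?j i] percepts length_percepts[of r i]
      unfolding node_in_round_def next_node_def node[OF less.prems(1) order_refl] by simp
  qed
  then show "node_in_round i r = walk i (Suc j div 2)"
    and "signal_of (next_action (config r) i) = Beep \<longleftrightarrow> odd j \<and> active i (Suc j div 2)"
    by auto
qed

text \<open>The agent \<open>i\<close> that hears first, in round \<open>s\<close>, answers in round \<open>s + 1\<close>, and the beeping
  partner, which stays for the second half of its walk round, hears this and answers in round \<open>s + 2\<close>. So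
  \<open>i\<close> hears a second beep and waits one round longer, which cancels its lead of one round.\<close>

lemma simultaneous_declaration:
  assumes hears: "hears_in_round i s" and first: "\<And>i r. r < s \<Longrightarrow> \<not> hears_in_round i r"
  shows "node_in_round Agent1 (s + 4) = node_in_round Agent2 (s + 4)"
    and "declares_in_round i' r \<longleftrightarrow> r = s + 4"
proof -
  let ?o = "other i"
  from hears have awake: "wake i \<le> s" "wake ?o \<le> s"
    and same: "node_in_round ?o s = node_in_round i s"
    and beep: "signal_of (next_action (config s) ?o) = Beep"
    by (auto simp: hears_in_round_iff)
  have fi: "first_hearing i s"
    using hears first by (simp add: first_hearing_def)
  have not_s: "\<not> hears_in_round ?o s"
    using beep by (simp add: hears_in_round_iff)
  have quiet: "\<not> hears_in_round ?o r" if "r < Suc s" for r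
    using that first not_s by (auto simp: less_Suc_eq)
  \<comment> \<open>Beeps occur only in odd own rounds, so the next own round of \<open>?o\<close>
    is an even one, spent waiting and listening.\<close>
  have "odd (Suc (s - wake ?o))"
    using run_before_hearing(2)[of ?o s] awake first beep by simp
  then have "next_action (config (Suc s)) ?o = Action Stay Listen False"
    using action_before_hearing[of "Suc s" ?o] quiet awake
    by (simp add: beeping_walk_def length_percepts Suc_diff_le Let_def)
  then have o_Suc: "node_in_round ?o (Suc s) = node_in_round ?o s"
      "signal_of (next_action (config (Suc s)) ?o) = Listen"
    using awake by (simp_all add: node_in_round_Stay node_config_Suc)
  have fo: "first_hearing ?o (Suc s)"
    using o_Suc same awake quiet node_after_hearing[OF fi, of "Suc s"] action_after_hearing[OF fi, of "Suc s"]
    by (simp add: first_hearing_def hears_in_round_iff)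
  have nodes: "node_in_round i r = node_in_round i s" "node_in_round ?o r = node_in_round i s"
    if "Suc s < r" for r
    using that node_after_hearing[OF fi, of r] node_after_hearing[OF fo, of r] o_Suc same by auto
  then have "node_in_round i (s + 4) = node_in_round ?o (s + 4)"
    by simp
  then show "node_in_round Agent1 (s + 4) = node_in_round Agent2 (s + 4)"
    by (cases i) auto
  have i2: "hears_in_round i (s + 2)"
    using awake nodes[of "s + 2"] action_after_hearing[OF fi, of "s + 2"] action_after_hearing[OF fo, of "s + 2"]
    by (simp add: hears_in_round_iff)
  \<comment> \<open>In round \<open>s + 3\<close> the agent \<open>i\<close> only listens, so
    \<open>?o\<close> declares three rounds after its hearing in round \<open>Suc s\<close>, which
    is round \<open>s + 4\<close>.\<close>
  have o2: "\<not> hears_in_round ?o (Suc s + 2)"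
    using action_after_hearing[OF fi, of "Suc s + 2"]
    by (simp add: hears_in_round_iff)
  have "declares_in_round i r \<longleftrightarrow> r = s + 4"
  proof (cases "s < r")
    case True
    then show ?thesis
      using action_after_hearing[OF fi True] i2 awake by (auto simp: declares_in_round_def)
  next
    case False
    then show ?thesis
      using no_declaration_before_hearing[of r i] first by auto
  qed
  moreover have "declares_in_round ?o r \<longleftrightarrow> r = s + 4"
  proof (cases "Suc s < r")
    case True
    then show ?thesis
      using action_after_hearing[OF fo True] o2 awake by (auto simp: declares_in_round_def)
  next
    case False
    then show ?thesis
      using no_declaration_before_hearing[of r ?o] quiet by auto
  qed
  ultimately have "\<forall>i'. declares_in_round i' r \<longleftrightarrow> r = s + 4"
    unfolding all_agent_iff[of _ i] by simp
  then show "declares_in_round i' r \<longleftrightarrow> r = s + 4" ..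
qed

section \<open>Existence and time of the first hearing\<close>

text \<open>With only two signals, different ones mean that one agent beeps while the other
  listens.\<close>

lemma beep_exchanged:
  assumes "wake i \<le> r" "wake (other i) \<le> r"
    and "node_in_round i r = node_in_round (other i) r"
    and "signal_of (next_action (config r) i) \<noteq> signal_of (next_action (config r) (other i))"
  shows "\<exists>i. hears_in_round i r"
proof -
  have "hears_in_round i r \<or> hears_in_round (other i) r"
    using assms
    by (cases "signal_of (next_action (config r) i)";
        cases "signal_of (next_action (config r) (other i))") (simp_all add: hears_in_round_iff)
  then show ?thesis by blast
qed

text \<open>If the wake-up times differ by an odd number, the first half of the walk round \<open>t\<close> of \<open>a\<close> coincides
  with the second half of the partner's round \<open>t + m\<close>, whose first half coincides with the second half of
  round \<open>t - 1\<close> of \<open>a\<close>. So a beep of \<open>a\<close> is heard in its round \<open>t\<close>, while a beep of the partner is heard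
  in round \<open>t - 1\<close> of \<open>a\<close>, when \<open>a\<close> already is at its node of the passive round \<open>t\<close>. In the latter case
  \<open>t > 1\<close> because the first round is always active.\<close>

lemma hearing_within:
  assumes later: "wake (other a) \<le> wake a" and "t > 0"
  defines "m \<equiv> (wake a - wake (other a)) div 2"
  assumes same: "walk a t = walk (other a) (t + m)"
    and differ: "active a t \<noteq> active (other a) (t + m)"
  shows "\<exists>i r. r \<le> wake a + 2 * (t - 1) \<and> hears_in_round i r"
proof (rule ccontr)
  assume "\<not> ?thesis"
  then have quiet: "\<And>i r. r \<le> wake a + 2 * (t - 1) \<Longrightarrow> \<not> hears_in_round i r"
    by blast
  obtain u where u: "t = Suc u"
    using \<open>t > 0\<close> by (cases t) auto
  have False if odd: "odd (wake a - wake (other a))" and "\<not> active a t"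
  proof -
    have active: "active (other a) (t + m)"
      using differ that by simp
    have "t \<noteq> 1"
      using that active_round_1[OF start_in_pverts[of a]] by auto
    then obtain u' where u': "t = Suc (Suc u')"
      using u by (cases u) auto
    \<comment> \<open>The second half of walk round \<open>t - 1\<close> of \<open>a\<close> and the
      first half of walk round \<open>t + m\<close> of the partner.\<close>
    define r where "r = wake a + 2 * u' + 1"
    have wake: "wake a = wake (other a) + 2 * m + 1"
      using later odd by (simp add: m_def) presburger
    have r: "wake a \<le> r" "wake (other a) \<le> r" "r \<le> wake a + 2 * (t - 1)"
      using later u' by (auto simp: r_def)
    have ja: "Suc (r - wake a) = 2 * (u' + 1)" and jo: "Suc (r - wake (other a)) = 2 * (u' + m + 1) + 1"
      using wake by (auto simp: r_def)
    have "walk a (Suc u') = walk a t"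
      using phi_walk_passive[OF \<open>t > 0\<close> \<open>\<not> active a t\<close>] u' by simp
    then have "node_in_round a r = node_in_round (other a) r"
      using run_before_hearing(1)[of a r] run_before_hearing(1)[of "other a" r] r quiet same u'
      unfolding ja jo by (simp del: phi_walk.simps)
    moreover have "signal_of (next_action (config r) a) \<noteq> Beep"
      using run_before_hearing(2)[of a r] r quiet unfolding ja by simp
    moreover have "signal_of (next_action (config r) (other a)) = Beep"
      using run_before_hearing(2)[of "other a" r] r quiet active u' unfolding jo by simp
    ultimately have "\<exists>i. hears_in_round i r"
      using r by (intro beep_exchanged[of a]) simp_all
    then show False
      using quiet r by blast
  qed
  moreover have False if "even (wake a - wake (other a)) \<or> active a t"
  proof -
    \<comment> \<open>The first half of walk round \<open>t\<close> of \<open>a\<close>.\<close>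
    define r where "r = wake a + 2 * u"
    have r: "wake a \<le> r" "wake (other a) \<le> r" "r \<le> wake a + 2 * (t - 1)"
      using later u by (auto simp: r_def)
    have ja: "Suc (r - wake a) = 2 * u + 1"
      by (simp add: r_def)
    have "Suc (r - wake (other a)) = 2 * u + (wake a - wake (other a)) + 1"
      using later by (simp add: r_def)
    \<comment> \<open>The partner is in walk round \<open>t + m\<close> for both parities; the
      parity only decides between its first and its second half.\<close>
    then have jo: "Suc (Suc (r - wake (other a))) div 2 = t + m"
        "odd (Suc (r - wake (other a))) \<longleftrightarrow> even (wake a - wake (other a))"
      using u by (auto simp: m_def)
    have "\<exists>i. hears_in_round i r"
    proof (rule beep_exchanged[OF r(1,2)])
      show "node_in_round a r = node_in_round (other a) r"
        using run_before_hearing(1)[of a r] run_before_hearing(1)[of "other a" r] r quiet same u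
        unfolding ja jo by (simp del: phi_walk.simps)
      have "signal_of (next_action (config r) a) = Beep \<longleftrightarrow> active a t"
        using run_before_hearing(2)[of a r] r quiet u unfolding ja by simp
      moreover have "signal_of (next_action (config r) (other a)) = Beep \<longleftrightarrow>
          even (wake a - wake (other a)) \<and> active (other a) (t + m)"
        using run_before_hearing(2)[of "other a" r] r quiet unfolding jo by simp
      ultimately show "signal_of (next_action (config r) a) \<noteq> signal_of (next_action (config r) (other a))"
        using that differ by metis
    qed
    then show False
      using quiet r by blast
  qed
  ultimately show False by blast
qed

text \<open>\<open>hearing_within\<close> bounds the time of some hearing;
  \<open>simultaneous_declaration\<close> is then applied to the earliest hearing of either
  agent.\<close>

lemma rendezvous:
  assumes meeting: "meeting_guarantee G port \<Phi> P"
    and labels: "\<And>i. L i > 0" "L Agent1 \<noteq> L Agent2"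
  defines "later \<equiv> max (wake Agent1) (wake Agent2)"
  shows "\<exists>r\<ge>later. node_in_round Agent1 r = node_in_round Agent2 r \<and>
    (\<forall>i r'. declares_in_round i r' \<longleftrightarrow> r' = r) \<and>
    real (r - later + 1)
      \<le> 2 * poly2 P (card (pverts G)) (floorlog 2 (min (L Agent1) (L Agent2))) + 5"
proof -
  define p where "p = poly2 P (card (pverts G)) (floorlog 2 (min (L Agent1) (L Agent2)))"
  obtain a where a: "wake (other a) \<le> wake a"
    using linear[of "wake Agent1" "wake Agent2"] that[of Agent1] that[of Agent2] by auto
  then have later: "later = wake a"
    by (cases a) (simp_all add: later_def max_absorb1 max_absorb2)
  define m where "m = (wake a - wake (other a)) div 2"
  have "L a \<noteq> L (other a)"
    using labels(2) labels(2)[symmetric] by (cases a) simp_all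
  have "min (L a) (L (other a)) = min (L Agent1) (L Agent2)"
    by (cases a) (simp_all add: min.commute)
  then have p: "p = poly2 P (card (pverts G)) (floorlog 2 (min (L a) (L (other a))))"
    by (simp only: p_def)
  \<comment> \<open>The guarantee is used on a clock of walk rounds: the walks start in its rounds
    \<open>m\<close> and \<open>0\<close>, where \<open>m\<close> is half the wake-up delay, rounded
    down.\<close>
  have "\<exists>r\<ge>m. real r \<le> real m + p \<and>
      walk a (r - m + 1) = walk (other a) (r - 0 + 1) \<and>
      active a (r - m + 1) \<noteq> active (other a) (r - 0 + 1)"
    unfolding p
    by (rule meeting[unfolded meeting_guarantee_def, rule_format])
      (simp add: labels(1) start_in_pverts \<open>L a \<noteq> L (other a)\<close>)
  then obtain r where r: "r \<ge> m" "real r \<le> real m + p"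
      "walk a (r - m + 1) = walk (other a) (r - 0 + 1)"
      "active a (r - m + 1) \<noteq> active (other a) (r - 0 + 1)"
    by (elim exE conjE)
  have "r - 0 + 1 = r - m + 1 + m"
    using r(1) by simp
  note same = r(3,4)[unfolded this, unfolded m_def]
  have "\<exists>i s. s \<le> wake a + 2 * (r - m + 1 - 1) \<and> hears_in_round i s"
    unfolding m_def by (rule hearing_within[OF a _ same]) simp
  then obtain s0 where s0: "s0 \<le> wake a + 2 * (r - m)" "\<exists>i. hears_in_round i s0"
    by auto
  define s where "s = (LEAST s. \<exists>i. hears_in_round i s)"
  obtain i where i: "hears_in_round i s"
    using LeastI_ex[of "\<lambda>s. \<exists>i. hears_in_round i s"] s0 unfolding s_def by blast
  have first: "\<not> hears_in_round i r" if "r < s" for i r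
    using not_less_Least[of r "\<lambda>s. \<exists>i. hears_in_round i s"] that unfolding s_def by blast
  have "s \<le> s0"
    unfolding s_def using s0 by (intro Least_le)
  \<comment> \<open>The \<open>5\<close> consists of the four rounds up to the declaration and one
    for counting round \<open>later\<close> itself.\<close>
  then have "s + 4 - later + 1 \<le> 2 * (r - m) + 5"
    using s0 later by simp
  then have "real (s + 4 - later + 1) \<le> 2 * real (r - m) + 5"
    by linarith
  also have "\<dots> \<le> 2 * p + 5"
    using r by (simp add: of_nat_diff)
  finally have "real (s + 4 - later + 1) \<le> 2 * p + 5" .
  moreover have "later \<le> s + 4"
    using i by (cases i) (auto simp: later_def hears_in_round_iff)
  moreover have "node_in_round Agent1 (s + 4) = node_in_round Agent2 (s + 4)"
    using i first by (rule simultaneous_declaration)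
  moreover have "declares_in_round i' r' \<longleftrightarrow> r' = s + 4" for i' r'
    using i first by (rule simultaneous_declaration)
  ultimately show ?thesis
    unfolding p_def by (intro exI[of _ "s + 4"] conjI allI)
qed

end

section \<open>The bound as a multiple of the polynomial\<close>

text \<open>Scaling by a constant stays among the polynomials, so one estimate yields both bounds of
  the theorem.\<close>

lemma poly2_smult: "poly2 (smult [:c:] P) x y = c * poly2 P x y"
  by (simp add: poly2_def)

theorem theorem3p1:
  fixes \<Phi> :: "nat \<Rightarrow> walk_fun" and P :: "real poly poly"
  assumes range: "\<And>L. L > 0 \<Longrightarrow> walk_fun_range (\<Phi> L)"
    and P_ge_1: "\<And>(n :: nat) (k :: nat). n \<ge> 2 \<Longrightarrow> k \<ge> 1 \<Longrightarrow> poly2 P (real n) (real k) \<ge> 1"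
    and meeting: "\<And>(G :: 'v pair_pre_digraph) port.
      port_graph G port \<Longrightarrow> meeting_guarantee G port \<Phi> P"
  shows "\<exists>C>0. \<exists>Q :: real poly poly.
    \<forall>(G :: 'v pair_pre_digraph) port L start wake.
      port_graph G port \<and> (\<forall>i. L i > 0) \<and> L Agent1 \<noteq> L Agent2 \<and> (\<forall>i. start i \<in> pverts G) \<longrightarrow>
      (let node = local_beeping.node_in_round G port (rv_with_detection \<Phi>) L start wake;
           declares = local_beeping.declares_in_round G port (rv_with_detection \<Phi>) L start wake;
           n = card (pverts G);
           l = min (L Agent1) (L Agent2);
           later = max (wake Agent1) (wake Agent2)
       in \<exists>r\<ge>later.
            node Agent1 r = node Agent2 r \<and>
            (\<forall>i r'. declares i r' \<longleftrightarrow> r' = r) \<and>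
            real (r - later + 1) \<le> C * poly2 P n (floorlog 2 l) \<and>
            real (r - later + 1) \<le> poly2 Q n (floorlog 2 l))"
proof (intro exI[of _ "7 :: real"] conjI exI[of _ "smult [:7:] P"] allI impI)
  fix G :: "'v pair_pre_digraph" and port and L :: "agent \<Rightarrow> nat" and start :: "agent \<Rightarrow> 'v"
    and wake :: "agent \<Rightarrow> nat"
  assume asm: "port_graph G port \<and> (\<forall>i. L i > 0) \<and> L Agent1 \<noteq> L Agent2 \<and> (\<forall>i. start i \<in> pverts G)"
  then interpret port_graph G port by blast
  interpret rv_run G port \<Phi> L start wake
    using asm by unfold_locales auto
  let ?p = "poly2 P (card (pverts G)) (floorlog 2 (min (L Agent1) (L Agent2)))"
  \<comment> \<open>Positive labels have binary length at least \<open>1\<close>, which brings the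
    arguments into the range of \<open>P_ge_1\<close>.\<close>
  have "floorlog 2 (min (L Agent1) (L Agent2)) \<ge> 1"
    using asm by (simp add: floorlog_def)
  then have "?p \<ge> 1"
    by (rule P_ge_1[OF two_nodes])
  then have bound: "x \<le> 7 * ?p" if "x \<le> 2 * ?p + 5" for x
    using that by linarith
  have "meeting_guarantee G port \<Phi> P"
    using asm by (intro meeting) (rule conjunct1)
  moreover have "\<And>i. L i > 0" "L Agent1 \<noteq> L Agent2"
    using asm by auto
  ultimately have "\<exists>r\<ge>max (wake Agent1) (wake Agent2).
      node_in_round Agent1 r = node_in_round Agent2 r \<and>
      (\<forall>i r'. declares_in_round i r' \<longleftrightarrow> r' = r) \<and>
      real (r - max (wake Agent1) (wake Agent2) + 1) \<le> 2 * ?p + 5"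
    by (rule rendezvous)
  then obtain r where r: "r \<ge> max (wake Agent1) (wake Agent2)"
      "node_in_round Agent1 r = node_in_round Agent2 r"
      "\<forall>i r'. declares_in_round i r' \<longleftrightarrow> r' = r"
      "real (r - max (wake Agent1) (wake Agent2) + 1) \<le> 2 * ?p + 5"
    by (elim exE conjE)
  from r(1-3) bound[OF r(4)]
  show "let node = node_in_round; declares = declares_in_round;
      n = card (pverts G); l = min (L Agent1) (L Agent2); later = max (wake Agent1) (wake Agent2)
    in \<exists>r\<ge>later. node Agent1 r = node Agent2 r \<and> (\<forall>i r'. declares i r' \<longleftrightarrow> r' = r) \<and>
      real (r - later + 1) \<le> 7 * poly2 P n (floorlog 2 l) \<and>
      real (r - later + 1) \<le> poly2 (smult [:7:] P) n (floorlog 2 l)"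
    unfolding Let_def poly2_smult by (intro exI[of _ r] conjI) assumption+
qed simp

end
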